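(* Let $G$ be a finite unicyclic graph whose unique cycle has length $n$ (an induced cycle $C_n$). If $n\geqslant 7$ and $\gcd(n,3)=1$, then $D_3(G)$ is connected.
   Context: A unicyclic graph is a connected graph containing exactly one cycle. The $3$-distance graph $D_3(G)$ has vertex set $V(G)$, two vertices being adjacent iff their distance in $G$ is exactly $3$. *)

theory Defs
  imports "Graph_Theory.Graph_Theory"
begin

text \<open>
  A finite simple graph is a \<^locale>\<open>pair_graph\<close>: every undirected edge is the pair of arcs
  \<open>(u, v)\<close>, \<open>(v, u)\<close>. The library counts a closed walk \<open>u, v, u\<close> along a single edge as a
  cycle, hence the bound on the length.
\<close>
definition ucycle :: "'a pair_pre_digraph \<Rightarrow> ('a \<times> 'a) awalk \<Rightarrow> bool" where
  "ucycle G p \<longleftrightarrow> pre_digraph.cycle (with_proj G) p \<and> 3 \<le> length p"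

text \<open>
  Arc walks carry a starting vertex and an orientation. The cycle as a subgraph, which is what
  is counted in \<open>unicyclic\<close>, is given by its undirected edges, i.e. the symmetric closure of its arcs.
\<close>
definition cycle_edges :: "('a \<times> 'a) awalk \<Rightarrow> 'a rel" where
  "cycle_edges p = set p \<union> (set p)\<inverse>"

definition unicyclic :: "'a pair_pre_digraph \<Rightarrow> bool" where
  "unicyclic G \<longleftrightarrow> Digraph_Component.connected (with_proj G) \<and>
    (\<exists>!C. \<exists>p. ucycle G p \<and> C = cycle_edges p)"

text \<open>With unit arc costs, \<^const>\<open>wf_digraph.\<mu>\<close> is the usual distance (\<open>\<infinity>\<close> if there is no walk).\<close>
definition gdist :: "'a pair_pre_digraph \<Rightarrow> 'a \<Rightarrow> 'a \<Rightarrow> ereal" where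
  "gdist G u v = wf_digraph.\<mu> (with_proj G) (\<lambda>_. 1) u v"

definition D3 :: "'a pair_pre_digraph \<Rightarrow> 'a pair_pre_digraph" where
  "D3 G = \<lparr> pverts = pverts G,
    parcs = {(u, v). u \<in> pverts G \<and> v \<in> pverts G \<and> gdist G u v = 3} \<rparr>"

end

theory Submission
  imports Defs "HOL-Number_Theory.Cong"
begin

text \<open>
  Every cycle of \<open>G\<close> has length \<open>n \<ge> 7\<close>, so there are no cycles of length 3, 4 or 5, and therefore
  the ends of any non-backtracking walk of length 3 are at distance exactly 3. Stepping by 3 along
  the cycle visits all its vertices because \<open>gcd n 3 = 1\<close>. A vertex off the cycle that reaches
  it in \<open>k\<close> steps is joined to one reaching it in fewer steps: follow the walk for 3 steps, going
  on along the cycle if \<open>k < 3\<close>.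
\<close>

text \<open>A shorter connection from \<open>a\<close> to \<open>d\<close> would close the walk up
  to a cycle that is too short: a triangle if \<open>a = d\<close>, a 4-cycle if they are adjacent,
  and a 5-cycle or a triangle if they have a common neighbour.\<close>

lemma (in pair_graph) gdist_eq_3:
  assumes E: "(a, b) \<in> parcs G" "(b, c) \<in> parcs G" "(c, d) \<in> parcs G"
    and "a \<noteq> c" "b \<noteq> d"
    and girth: "\<And>q. ucycle G q \<Longrightarrow> length q \<ge> 6"
  shows "gdist G a d = 3"
proof -
  have verts: "a \<in> pverts G" "b \<in> pverts G" "c \<in> pverts G" "d \<in> pverts G"
    using E by (auto dest: in_arcsD1 in_arcsD2)
  have ne: "a \<noteq> b" "b \<noteq> c" "c \<noteq> d"
    using E no_loops' by auto
  have no_triangle: False if "(x, y) \<in> parcs G" "(y, z) \<in> parcs G" "(z, x) \<in> parcs G" for x y z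
  proof -
    have "ucycle G [(x, y), (y, z), (z, x)]"
      using that no_loops' by (auto simp: ucycle_def cycle_def awalk_simps dest: in_arcsD1)
    from girth[OF this] show False by simp
  qed
  have "a \<noteq> d"
    using no_triangle E by blast
  have 1: "(a, d) \<notin> parcs G"
  proof
    assume "(a, d) \<in> parcs G"
    then have "ucycle G [(a, b), (b, c), (c, d), (d, a)]"
      using E arcs_symmetric verts ne \<open>a \<noteq> c\<close> \<open>b \<noteq> d\<close> \<open>a \<noteq> d\<close>
      by (auto simp: ucycle_def cycle_def awalk_simps)
    from girth[OF this] show False by simp
  qed
  have 2: False if y: "(a, y) \<in> parcs G" "(y, d) \<in> parcs G" for y
  proof -
    \<comment> \<open>\<open>y = b\<close> would give the triangle \<open>b\<close>,
      \<open>c\<close>, \<open>d\<close>, and \<open>y = c\<close> the triangle \<open>a\<close>,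
      \<open>b\<close>, \<open>c\<close>.\<close>
    have "y \<noteq> b" "y \<noteq> c"
      using no_triangle y E arcs_symmetric by metis+
    moreover have "y \<noteq> a" "y \<noteq> d"
      using y no_loops' by blast+
    ultimately have "ucycle G [(a, b), (b, c), (c, d), (d, y), (y, a)]"
      using y E arcs_symmetric verts ne \<open>a \<noteq> c\<close> \<open>b \<noteq> d\<close> \<open>a \<noteq> d\<close>
      by (auto simp: ucycle_def cycle_def awalk_simps)
    from girth[OF this] show False by simp
  qed
  have cost: "awalk_cost (\<lambda>_. 1) q = real (length q)" for q :: "('a \<times> 'a) awalk"
    by (induct q) auto
  have "\<mu> (\<lambda>_. 1) a d \<le> ereal (awalk_cost (\<lambda>_. 1) [(a, b), (b, c), (c, d)])"
    using E verts by (intro min_cost_le_walk_cost) (auto simp: awalk_simps)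
  moreover have "3 \<le> \<mu> (\<lambda>_. 1) a d"
    unfolding \<mu>_def
  proof (rule INF_greatest)
    fix q assume "q \<in> {q. awalk a q d}"
    then have q: "awalk a q d" by simp
    have "3 \<le> length q"
    proof (rule ccontr)
      assume "\<not> 3 \<le> length q"
      then consider "q = []" | e where "q = [e]" | e f where "q = [e, f]"
        by (cases q; cases "tl q"; cases "tl (tl q)") auto
      then show False
        by cases (use q \<open>a \<noteq> d\<close> 1 2 in \<open>auto simp: awalk_simps\<close>)
    qed
    then show "3 \<le> ereal (awalk_cost (\<lambda>_. 1) q)"
      by (simp add: cost)
  qed
  ultimately show ?thesis
    by (simp add: gdist_def)
qed

text \<open>The vertex list of the closed walk can be read off from the tails or from the heads of
  its arcs; comparing the two readings gives these facts. The first makes the vertex set depend only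
  on the undirected edges, the others allow cyclic indexing by heads.\<close>

lemma (in pair_graph) ucycle_vertices:
  assumes "ucycle G q"
  shows "fst ` cycle_edges q = snd ` set q" "distinct (map snd q)"
    "\<And>i. Suc i < length q \<Longrightarrow> fst (q ! Suc i) = snd (q ! i)"
    "fst (hd q) = snd (last q)"
proof -
  obtain u where w: "awalk u q u" and d: "distinct (tl (pawalk_verts u q))" and "q \<noteq> []"
    using assms by (auto simp: ucycle_def cycle_def)
  then have cas: "pcas u q u" by auto
  have l: "pawalk_verts u q = map fst q @ [snd (last q)]"
    using awalk_verts_conv \<open>q \<noteq> []\<close> by simp
  have r: "pawalk_verts u q = fst (hd q) # map snd q"
    using awalk_verts_conv'[OF cas] \<open>q \<noteq> []\<close> by simp
  show "distinct (map snd q)"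
    using d r by simp
  have eq: "map fst q @ [snd (last q)] = fst (hd q) # map snd q"
    using l r by simp
  show closed: "fst (hd q) = snd (last q)"
    using w l r awhd_of_awalk[OF w] awlast_of_awalk[OF w]
    by (metis awalkE' last_snoc list.sel(1))
  show "fst (q ! Suc i) = snd (q ! i)" if "Suc i < length q" for i
    using arg_cong[OF eq, of "\<lambda>xs. xs ! Suc i"] that by (simp add: nth_append)
  have "fst ` set q \<subseteq> snd ` set q"
    using arg_cong[OF eq, of set] closed \<open>q \<noteq> []\<close> by auto
  then show "fst ` cycle_edges q = snd ` set q"
    by (auto simp: cycle_edges_def image_Un) (force simp: image_iff)+
qed

text \<open>Uniqueness identifies only the undirected edge sets, since the start and the orientation
  of the two walks may differ. The edges determine the vertices, and as the heads are distinct, the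
  length is the number of vertices.\<close>

lemma (in pair_graph) unicyclic_length_eq:
  assumes "unicyclic G" "ucycle G p" "ucycle G q"
  shows "length p = length q"
proof -
  have "cycle_edges p = cycle_edges q"
    using assms by (auto simp: unicyclic_def)
  then have "snd ` set p = snd ` set q"
    using ucycle_vertices(1) assms by metis
  then have "card (set (map snd p)) = card (set (map snd q))"
    by simp
  then show ?thesis
    using ucycle_vertices(2) assms by (metis distinct_card length_map)
qed

lemma (in pair_graph) D3_arcI:
  assumes "(a, b) \<in> parcs G" "(b, c) \<in> parcs G" "(c, d) \<in> parcs G" "a \<noteq> c" "b \<noteq> d"
    and "\<And>q. ucycle G q \<Longrightarrow> length q \<ge> 6"
  shows "(a, d) \<in> parcs (D3 G)"
  using assms gdist_eq_3 by (auto simp: D3_def dest: in_arcsD1 in_arcsD2)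

text \<open>Connectedness is defined through the symmetric closure of the arcs. Its reachability
  relation is symmetric, so any two vertices can be joined through the root
  \<open>r\<close>.\<close>

lemma D3_connectedI:
  assumes "r \<in> pverts G"
    and "\<And>v. v \<in> pverts G \<Longrightarrow> (v, r) \<in> (parcs (D3 G) \<union> (parcs (D3 G))\<inverse>)\<^sup>*"
  shows "Digraph_Component.connected (with_proj (D3 G))"
proof -
  let ?S = "parcs (D3 G) \<union> (parcs (D3 G))\<inverse>"
  interpret D: pair_wf_digraph "D3 G"
    by unfold_locales (auto simp: D3_def)
  interpret M: pair_wf_digraph "mk_symmetric (with_proj (D3 G))"
    by (rule D.wellformed_mk_symmetric)
  have arcs: "parcs (mk_symmetric (with_proj (D3 G))) = ?S"
    by (force simp: mk_symmetric_def)
  have verts: "pverts (D3 G) = pverts G"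
    by (simp add: D3_def)
  have "sym (?S\<^sup>*)"
    by (intro sym_rtrancl sym_Un_converse)
  then have "(u, v) \<in> ?S\<^sup>*" if "u \<in> pverts G" "v \<in> pverts G" for u v
    using that assms(2) by (meson rtrancl_trans symD)
  then show ?thesis
    using assms(1)
    by (auto simp: connected_def strongly_connected_def M.reachable_conv arcs verts)
qed

theorem theorem2p8:
  fixes G :: "'a pair_pre_digraph" and p :: "('a \<times> 'a) awalk" and n :: nat
  assumes "pair_graph G"
    and "unicyclic G"
    and "ucycle G p" and "length p = n"
    and "n \<ge> 7" and "gcd n 3 = 1"
  shows "Digraph_Component.connected (with_proj (D3 G))"
proof -
  interpret pair_graph G by fact
  have girth: "length q \<ge> 6" if "ucycle G q" for q
    using unicyclic_length_eq[OF assms(2,3) that] assms(4,5) by simp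
  note D3I = D3_arcI[OF _ _ _ _ _ girth]
  \<comment> \<open>The cycle is indexed periodically by all naturals, so that walks can run on past
    its end. Heads serve as vertices because they are known to be distinct.\<close>
  define c where "c i = snd (p ! (i mod n))" for i
  have "n > 0" "p \<noteq> []"
    using assms(4,5) by auto
  have c_adj: "(c i, c (Suc i)) \<in> parcs G" for i
  proof -
    have "c i = fst (p ! (Suc i mod n))"
    proof (cases "Suc (i mod n) = n")
      case True
      then have "i mod n = n - 1" "Suc i mod n = 0"
        by (simp_all add: mod_Suc)
      then show ?thesis
        using ucycle_vertices(4)[OF assms(3)] \<open>p \<noteq> []\<close> assms(4)
        by (simp add: c_def hd_conv_nth last_conv_nth)
    next
      case False
      then have "Suc (i mod n) < length p"
        using mod_less_divisor[OF \<open>n > 0\<close>, of i] assms(4) by linarith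
      then show ?thesis
        using ucycle_vertices(3)[OF assms(3)] False by (simp add: c_def mod_Suc)
    qed
    moreover have "p ! (Suc i mod n) \<in> parcs G"
      using assms(3,4) \<open>n > 0\<close> nth_mem[of "Suc i mod n" p]
      by (auto simp: ucycle_def cycle_def awalk_def)
    ultimately show ?thesis
      by (simp add: c_def)
  qed
  have c_ne: "c i \<noteq> c (Suc (Suc i))" for i
  proof
    assume "c i = c (Suc (Suc i))"
    then have "i mod n = Suc (Suc i) mod n"
      using nth_eq_iff_index_eq[OF ucycle_vertices(2)[OF assms(3)]] assms(4) \<open>n > 0\<close>
      by (simp add: c_def)
    then have "[i + 2 = i + 0] (mod n)"
      by (simp add: cong_def)
    then have "n dvd 2"
      by (simp only: cong_add_lcancel_nat cong_0_iff)
    then show False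
      using assms(5) by (auto dest: dvd_imp_le)
  qed
  let ?S = "(parcs (D3 G) \<union> (parcs (D3 G))\<inverse>)\<^sup>*"
  have c_step: "(c (3 * m), c 0) \<in> ?S" for m
  proof (induct m)
    case (Suc m)
    have "(c (3 * m), c (3 * Suc m)) \<in> parcs (D3 G)"
      using D3I[OF c_adj[of "3 * m"] c_adj c_adj c_ne c_ne] by (simp add: numeral_3_eq_3)
    then show ?case
      using Suc by (blast intro: converse_rtrancl_into_rtrancl)
  qed simp
  have c_S: "(c i, c 0) \<in> ?S" for i
  proof -
    have "coprime 3 n"
      using assms(6) by (simp add: coprime_iff_gcd_eq_1 gcd.commute)
    \<comment> \<open>As \<open>x\<close> inverts 3 modulo \<open>n\<close>, making
      \<open>x * i\<close> steps of size 3 from \<open>c 0\<close> ends at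
      \<open>c i\<close>.\<close>
    then obtain x where "[3 * x = Suc 0] (mod n)"
      using cong_solve_coprime_nat by blast
    then have "[3 * x * i = Suc 0 * i] (mod n)"
      by (rule cong_scalar_right)
    then show ?thesis
      using c_step[of "x * i"] by (simp add: c_def cong_def mult.assoc)
  qed
  \<comment> \<open>The walk may backtrack and need not be shortest. The index \<open>i\<close> is
    generalized in the induction because the point where the cycle is reached can shift.\<close>
  have near: "(v, c 0) \<in> ?S" if "(v, c i) \<in> parcs G ^^ k" for v i k
    using that
  proof (induct k arbitrary: v i rule: less_induct)
    case (less k)
    have step: "(v, c 0) \<in> ?S"
      if "(v, x) \<in> parcs G" "(x, y) \<in> parcs G" "(y, w) \<in> parcs G" "v \<noteq> y" "x \<noteq> w" "(w, c 0) \<in> ?S" for x y w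
      using D3I[OF that(1-5)] that(6) by (blast intro: converse_rtrancl_into_rtrancl)
    consider "k = 0" | "k = 1" | "k = 2" | j where "k = Suc (Suc (Suc j))"
      by (metis One_nat_def Suc_1 not0_implies_Suc)
    then show ?case
    proof cases
      case 1
      then show ?thesis using less.prems c_S by simp
    next
      case 2
      then have v: "(v, c i) \<in> parcs G"
        using less.prems by simp
      show ?thesis
      \<comment> \<open>The walk is prolonged by two steps along the cycle, to
        \<open>c (Suc (Suc i))\<close>. It backtracks only if \<open>v\<close> already lies on the
        cycle.\<close>
      proof (cases "v = c (Suc i)")
        case False
        then show ?thesis using step v c_adj c_ne c_S by blast
      qed (use c_S in simp)
    next
      case 3
      then obtain u where u: "(v, u) \<in> parcs G" "(u, c i) \<in> parcs G"
        using less.prems by (auto simp: numeral_2_eq_2)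
      show ?thesis
      proof (cases "v = c i")
        case False
        show ?thesis
        \<comment> \<open>If going on to \<open>c (Suc i)\<close> would backtrack, then
          \<open>v\<close> is adjacent to \<open>c (Suc i)\<close>, which is the case of length 1
          with a shifted index.\<close>
        proof (cases "u = c (Suc i)")
          case True
          then show ?thesis
            using less.hyps[of 1 v "Suc i"] u 3 by simp
        next
          case F: False
          then show ?thesis
            using step[OF u c_adj False F c_S] by simp
        qed
      qed (use c_S in simp)
    next
      case 4
      then obtain x y w where w: "(v, x) \<in> parcs G" "(x, y) \<in> parcs G" "(y, w) \<in> parcs G"
        "(w, c i) \<in> parcs G ^^ j"
        using less.prems by (metis relpow_Suc_E2)
      show ?thesis
      \<comment> \<open>If the first three steps backtrack, cutting out the detour leaves a walk of
        length \<open>Suc j\<close> from \<open>v\<close>; otherwise \<open>v\<close> and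
        \<open>w\<close> are adjacent in \<open>D3 G\<close> and \<open>w\<close> has a walk of
        length \<open>j\<close>.\<close>
      proof (cases "v = y")
        case True
        then show ?thesis
          using less.hyps[of "Suc j" v i] relpow_Suc_I2[OF w(3,4)] 4 by simp
      next
        case vy: False
        show ?thesis
        proof (cases "x = w")
          case True
          then show ?thesis
            using less.hyps[of "Suc j" v i] relpow_Suc_I2[of v w "parcs G" "c i" j] w 4 by simp
        next
          case False
          then show ?thesis
            using step[OF w(1-3) vy False] less.hyps[OF _ w(4)] 4 by simp
        qed
      qed
    qed
  qed
  have c0: "c 0 \<in> pverts G"
    using c_adj in_arcsD1 by blast
  show ?thesis
  proof (rule D3_connectedI[OF c0])
    fix v assume "v \<in> pverts G"
    \<comment> \<open>The arcs of \<open>G\<close> are symmetric, so reachability in the symmetric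
      closure is reachability in \<open>G\<close> itself.\<close>
    have "v \<rightarrow>\<^sup>*\<^bsub>with_proj G\<^esub> c 0"
      using assms(2) \<open>v \<in> pverts G\<close> c0
        reachable_mk_symmetric_eq[OF sym_arcs]
      by (auto simp: unicyclic_def connected_def strongly_connected_def mk_symmetric_def)
    then obtain k where "(v, c 0) \<in> parcs G ^^ k"
      using reachable_rtranclI rtrancl_imp_relpow by (metis with_proj_simps(3))
    then show "(v, c 0) \<in> ?S"
      by (rule near)
  qed
qed

end
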